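(* Let $R$ be a noetherian ring, and let $M$ be a finitely generated, nonsingular, pure extending right $R$-module. Then $M$ is centrally quasi-morphic if and only if it is centrally morphic.
   Context: Rings are associative with identity, modules are unital right modules, and $S=\operatorname{End}_R(M)$. A submodule $P \leq M$ is pure if for every left $R$-module $L$ the induced map $P\otimes_R L \to M\otimes_R L$ is injective. $M$ is pure extending if every pure submodule of $M$ is essential in a direct summand of $M$. $M$ is nonsingular if its singular submodule is zero. $M$ is centrally quasi-morphic if for every $f\in S$ there exist $g,h$ in the center of $S$ such that $\ker(f)=\operatorname{Im}(g)$ and $\operatorname{Im}(f)=\ker(h)$; $M$ is centrally morphic if for every $f\in S$ one can choose $g=h$, i.e. there is $g$ in the center of $S$ with $\ker(f)=\operatorname{Im}(g)$ and $\operatorname{Im}(f)=\ker(g)$. *)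

theory Defs
  imports "HOL-Algebra.Algebra"
begin

section \<open>Modules over a noncommutative ring\<close>

text \<open>The locale \<^locale>\<open>module\<close> of HOL-Algebra requires a commutative ring.  Left modules
  reuse its record; right modules get their own record, with the scalar written on the right.
  As in HOL-Algebra, the multiplicative fields of these records play no role.\<close>

locale left_module = R?: ring R + L?: abelian_group L
  for R :: "('r, 'x) ring_scheme" (structure) and L :: "('r, 'l, 'z) module_scheme" (structure) +
  assumes smult_closed:
      "\<lbrakk>a \<in> carrier R; x \<in> carrier L\<rbrakk> \<Longrightarrow> a \<odot>\<^bsub>L\<^esub> x \<in> carrier L"
    and smult_l_distr:
      "\<lbrakk>a \<in> carrier R; b \<in> carrier R; x \<in> carrier L\<rbrakk> \<Longrightarrow>
        (a \<oplus>\<^bsub>R\<^esub> b) \<odot>\<^bsub>L\<^esub> x = a \<odot>\<^bsub>L\<^esub> x \<oplus>\<^bsub>L\<^esub> b \<odot>\<^bsub>L\<^esub> x"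
    and smult_r_distr:
      "\<lbrakk>a \<in> carrier R; x \<in> carrier L; y \<in> carrier L\<rbrakk> \<Longrightarrow>
        a \<odot>\<^bsub>L\<^esub> (x \<oplus>\<^bsub>L\<^esub> y) = a \<odot>\<^bsub>L\<^esub> x \<oplus>\<^bsub>L\<^esub> a \<odot>\<^bsub>L\<^esub> y"
    and smult_assoc:
      "\<lbrakk>a \<in> carrier R; b \<in> carrier R; x \<in> carrier L\<rbrakk> \<Longrightarrow>
        (a \<otimes>\<^bsub>R\<^esub> b) \<odot>\<^bsub>L\<^esub> x = a \<odot>\<^bsub>L\<^esub> (b \<odot>\<^bsub>L\<^esub> x)"
    and smult_one:
      "x \<in> carrier L \<Longrightarrow> \<one>\<^bsub>R\<^esub> \<odot>\<^bsub>L\<^esub> x = x"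

record ('a, 'b) right_module = "'b ring" +
  rsmult :: "['b, 'a] \<Rightarrow> 'b" (infixl \<open>\<bullet>\<index>\<close> 70)

locale right_module = R?: ring R + M?: abelian_group M
  for R :: "('r, 'x) ring_scheme" (structure) and M :: "('r, 'm, 'y) right_module_scheme" (structure) +
  assumes rsmult_closed:
      "\<lbrakk>x \<in> carrier M; a \<in> carrier R\<rbrakk> \<Longrightarrow> x \<bullet>\<^bsub>M\<^esub> a \<in> carrier M"
    and rsmult_l_distr:
      "\<lbrakk>x \<in> carrier M; y \<in> carrier M; a \<in> carrier R\<rbrakk> \<Longrightarrow>
        (x \<oplus>\<^bsub>M\<^esub> y) \<bullet>\<^bsub>M\<^esub> a = x \<bullet>\<^bsub>M\<^esub> a \<oplus>\<^bsub>M\<^esub> y \<bullet>\<^bsub>M\<^esub> a"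
    and rsmult_r_distr:
      "\<lbrakk>x \<in> carrier M; a \<in> carrier R; b \<in> carrier R\<rbrakk> \<Longrightarrow>
        x \<bullet>\<^bsub>M\<^esub> (a \<oplus>\<^bsub>R\<^esub> b) = x \<bullet>\<^bsub>M\<^esub> a \<oplus>\<^bsub>M\<^esub> x \<bullet>\<^bsub>M\<^esub> b"
    and rsmult_assoc:
      "\<lbrakk>x \<in> carrier M; a \<in> carrier R; b \<in> carrier R\<rbrakk> \<Longrightarrow>
        x \<bullet>\<^bsub>M\<^esub> (a \<otimes>\<^bsub>R\<^esub> b) = (x \<bullet>\<^bsub>M\<^esub> a) \<bullet>\<^bsub>M\<^esub> b"
    and rsmult_one:
      "x \<in> carrier M \<Longrightarrow> x \<bullet>\<^bsub>M\<^esub> \<one>\<^bsub>R\<^esub> = x"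

definition right_submodule ::
    "'m set \<Rightarrow> ('r, 'x) ring_scheme \<Rightarrow> ('r, 'm, 'y) right_module_scheme \<Rightarrow> bool"
  where "right_submodule N R M \<longleftrightarrow>
    subgroup N (add_monoid M) \<and> (\<forall>x\<in>N. \<forall>a\<in>carrier R. x \<bullet>\<^bsub>M\<^esub> a \<in> N)"

definition right_span ::
    "('r, 'x) ring_scheme \<Rightarrow> ('r, 'm, 'y) right_module_scheme \<Rightarrow> 'm set \<Rightarrow> 'm set"
  where "right_span R M A = \<Inter>{N. right_submodule N R M \<and> A \<subseteq> N}"

definition finitely_generated ::
    "('r, 'x) ring_scheme \<Rightarrow> ('r, 'm, 'y) right_module_scheme \<Rightarrow> bool"
  where "finitely_generated R M \<longleftrightarrow>
    (\<exists>A \<subseteq> carrier M. finite A \<and> right_span R M A = carrier M)"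

text \<open>The ring as a right module over itself; its submodules are the right ideals.\<close>

definition regular_right_module :: "('r, 'x) ring_scheme \<Rightarrow> ('r, 'r) right_module"
  where "regular_right_module R =
    \<lparr>carrier = carrier R, monoid.mult = (\<otimes>\<^bsub>R\<^esub>), one = \<one>\<^bsub>R\<^esub>,
     ring.zero = \<zero>\<^bsub>R\<^esub>, ring.add = (\<oplus>\<^bsub>R\<^esub>), rsmult = (\<otimes>\<^bsub>R\<^esub>)\<rparr>"

definition opposite_ring :: "('r, 'x) ring_scheme \<Rightarrow> 'r ring"
  where "opposite_ring R =
    \<lparr>carrier = carrier R, monoid.mult = (\<lambda>a b. b \<otimes>\<^bsub>R\<^esub> a), one = \<one>\<^bsub>R\<^esub>,
     ring.zero = \<zero>\<^bsub>R\<^esub>, ring.add = (\<oplus>\<^bsub>R\<^esub>)\<rparr>"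

definition right_noetherian :: "('r, 'x) ring_scheme \<Rightarrow> bool"
  where "right_noetherian R \<longleftrightarrow>
    (\<forall>I. right_submodule I R (regular_right_module R) \<longrightarrow>
      (\<exists>A \<subseteq> I. finite A \<and> right_span R (regular_right_module R) A = I))"

text \<open>Noetherian on both sides.  The locale \<^locale>\<open>noetherian_ring\<close> of HOL-Algebra speaks
  of two-sided ideals only, which over a noncommutative ring is a weaker condition.\<close>

definition noetherian :: "('r, 'x) ring_scheme \<Rightarrow> bool"
  where "noetherian R \<longleftrightarrow> right_noetherian R \<and> right_noetherian (opposite_ring R)"

definition essential_in ::
    "'m set \<Rightarrow> 'm set \<Rightarrow> ('r, 'x) ring_scheme \<Rightarrow> ('r, 'm, 'y) right_module_scheme \<Rightarrow> bool"
  where "essential_in N K R M \<longleftrightarrow>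
    right_submodule N R M \<and> right_submodule K R M \<and> N \<subseteq> K \<and>
    (\<forall>T. right_submodule T R M \<and> T \<subseteq> K \<and> T \<noteq> {\<zero>\<^bsub>M\<^esub>} \<longrightarrow> N \<inter> T \<noteq> {\<zero>\<^bsub>M\<^esub>})"

definition direct_summand ::
    "'m set \<Rightarrow> ('r, 'x) ring_scheme \<Rightarrow> ('r, 'm, 'y) right_module_scheme \<Rightarrow> bool"
  where "direct_summand K R M \<longleftrightarrow>
    right_submodule K R M \<and>
    (\<exists>K'. right_submodule K' R M \<and> K \<inter> K' = {\<zero>\<^bsub>M\<^esub>} \<and> K <+>\<^bsub>M\<^esub> K' = carrier M)"

definition right_annihilator ::
    "('r, 'x) ring_scheme \<Rightarrow> ('r, 'm, 'y) right_module_scheme \<Rightarrow> 'm \<Rightarrow> 'r set"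
  where "right_annihilator R M x = {a \<in> carrier R. x \<bullet>\<^bsub>M\<^esub> a = \<zero>\<^bsub>M\<^esub>}"

definition singular_submodule ::
    "('r, 'x) ring_scheme \<Rightarrow> ('r, 'm, 'y) right_module_scheme \<Rightarrow> 'm set"
  where "singular_submodule R M =
    {x \<in> carrier M. essential_in (right_annihilator R M x) (carrier R) R (regular_right_module R)}"

definition nonsingular :: "('r, 'x) ring_scheme \<Rightarrow> ('r, 'm, 'y) right_module_scheme \<Rightarrow> bool"
  where "nonsingular R M \<longleftrightarrow> singular_submodule R M = {\<zero>\<^bsub>M\<^esub>}"


section \<open>Tensor products and purity\<close>

definition tensor_relators ::
    "('r, 'x) ring_scheme \<Rightarrow> ('r, 'm, 'y) right_module_scheme \<Rightarrow> ('r, 'l, 'z) module_scheme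
      \<Rightarrow> ('m \<times> 'l \<Rightarrow>\<^sub>0 int) set"
  where "tensor_relators R M L =
    {frag_of (x \<oplus>\<^bsub>M\<^esub> y, l) - frag_of (x, l) - frag_of (y, l) | x y l.
       x \<in> carrier M \<and> y \<in> carrier M \<and> l \<in> carrier L} \<union>
    {frag_of (x, l \<oplus>\<^bsub>L\<^esub> k) - frag_of (x, l) - frag_of (x, k) | x l k.
       x \<in> carrier M \<and> l \<in> carrier L \<and> k \<in> carrier L} \<union>
    {frag_of (x \<bullet>\<^bsub>M\<^esub> a, l) - frag_of (x, a \<odot>\<^bsub>L\<^esub> l) | x a l.
       x \<in> carrier M \<and> a \<in> carrier R \<and> l \<in> carrier L}"

definition tensor_kernel ::
    "('r, 'x) ring_scheme \<Rightarrow> ('r, 'm, 'y) right_module_scheme \<Rightarrow> ('r, 'l, 'z) module_scheme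
      \<Rightarrow> ('m \<times> 'l \<Rightarrow>\<^sub>0 int) set"
  where "tensor_kernel R M L =
    generate (free_Abelian_group (carrier M \<times> carrier L)) (tensor_relators R M L)"

definition tensor_product ::
    "('r, 'x) ring_scheme \<Rightarrow> ('r, 'm, 'y) right_module_scheme \<Rightarrow> ('r, 'l, 'z) module_scheme
      \<Rightarrow> ('m \<times> 'l \<Rightarrow>\<^sub>0 int) set monoid"
  where "tensor_product R M L =
    free_Abelian_group (carrier M \<times> carrier L) Mod tensor_kernel R M L"

text \<open>For a submodule \<open>P\<close> of \<open>M\<close> the map \<open>P \<otimes> L \<rightarrow> M \<otimes> L\<close> induced by the inclusion enlarges
  a coset of the smaller kernel to the coset of the larger kernel containing it; see
  \<open>tensor_inclusion_rcos\<close> below.\<close>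

definition tensor_inclusion ::
    "('r, 'x) ring_scheme \<Rightarrow> ('r, 'm, 'y) right_module_scheme \<Rightarrow> ('r, 'l, 'z) module_scheme
      \<Rightarrow> ('m \<times> 'l \<Rightarrow>\<^sub>0 int) set \<Rightarrow> ('m \<times> 'l \<Rightarrow>\<^sub>0 int) set"
  where "tensor_inclusion R M L T =
    tensor_kernel R M L <#>\<^bsub>free_Abelian_group (carrier M \<times> carrier L)\<^esub> T"

definition inclusion_stays_injective ::
    "'m set \<Rightarrow> ('r, 'x) ring_scheme \<Rightarrow> ('r, 'm, 'y) right_module_scheme
      \<Rightarrow> ('r, 'l, 'z) module_scheme \<Rightarrow> bool"
  where "inclusion_stays_injective P R M L \<longleftrightarrow>
    inj_on (tensor_inclusion R M L) (carrier (tensor_product R (M\<lparr>carrier := P\<rparr>) L))"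

text \<open>HOL cannot quantify over all types inside a formula, so \<open>L\<close> ranges over the left modules
  whose elements are sets of lists over \<open>R\<close>.  Every finitely generated left module, being a
  quotient of some \<open>R\<^sup>n\<close>, has a copy there, and these suffice: \<open>pure_imp_injective\<close> below
  shows that the condition then holds for left modules over any type.\<close>

definition pure_submodule ::
    "'m set \<Rightarrow> ('r, 'x) ring_scheme \<Rightarrow> ('r, 'm, 'y) right_module_scheme \<Rightarrow> bool"
  where "pure_submodule P R M \<longleftrightarrow>
    right_submodule P R M \<and>
    (\<forall>L :: ('r, 'r list set) module. left_module R L \<longrightarrow> inclusion_stays_injective P R M L)"

definition pure_extending :: "('r, 'x) ring_scheme \<Rightarrow> ('r, 'm, 'y) right_module_scheme \<Rightarrow> bool"
  where "pure_extending R M \<longleftrightarrow>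
    (\<forall>P. pure_submodule P R M \<longrightarrow> (\<exists>K. direct_summand K R M \<and> essential_in P K R M))"


section \<open>The endomorphism ring\<close>

text \<open>Endomorphisms are extensional functions, so that equality in the ring is equality of maps
  on the carrier.\<close>

definition endomorphism_ring ::
    "('r, 'x) ring_scheme \<Rightarrow> ('r, 'm, 'y) right_module_scheme \<Rightarrow> ('m \<Rightarrow> 'm) ring"
  where "endomorphism_ring R M =
    \<lparr>carrier = {f \<in> carrier M \<rightarrow>\<^sub>E carrier M.
        (\<forall>x\<in>carrier M. \<forall>y\<in>carrier M. f (x \<oplus>\<^bsub>M\<^esub> y) = f x \<oplus>\<^bsub>M\<^esub> f y) \<and>
        (\<forall>x\<in>carrier M. \<forall>a\<in>carrier R. f (x \<bullet>\<^bsub>M\<^esub> a) = f x \<bullet>\<^bsub>M\<^esub> a)},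
     monoid.mult = (\<lambda>f g. \<lambda>x\<in>carrier M. f (g x)),
     one = (\<lambda>x\<in>carrier M. x),
     ring.zero = (\<lambda>x\<in>carrier M. \<zero>\<^bsub>M\<^esub>),
     ring.add = (\<lambda>f g. \<lambda>x\<in>carrier M. f x \<oplus>\<^bsub>M\<^esub> g x)\<rparr>"

definition ring_center :: "('a, 'x) ring_scheme \<Rightarrow> 'a set"
  where "ring_center S =
    {z \<in> carrier S. \<forall>s\<in>carrier S. z \<otimes>\<^bsub>S\<^esub> s = s \<otimes>\<^bsub>S\<^esub> z}"

definition centrally_quasi_morphic ::
    "('r, 'x) ring_scheme \<Rightarrow> ('r, 'm, 'y) right_module_scheme \<Rightarrow> bool"
  where "centrally_quasi_morphic R M \<longleftrightarrow>
    (\<forall>f \<in> carrier (endomorphism_ring R M).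
      \<exists>g \<in> ring_center (endomorphism_ring R M). \<exists>h \<in> ring_center (endomorphism_ring R M).
        a_kernel M M f = g ` carrier M \<and> f ` carrier M = a_kernel M M h)"

definition centrally_morphic ::
    "('r, 'x) ring_scheme \<Rightarrow> ('r, 'm, 'y) right_module_scheme \<Rightarrow> bool"
  where "centrally_morphic R M \<longleftrightarrow>
    (\<forall>f \<in> carrier (endomorphism_ring R M).
      \<exists>g \<in> ring_center (endomorphism_ring R M).
        a_kernel M M f = g ` carrier M \<and> f ` carrier M = a_kernel M M g)"

lemma ring_endomorphism_ring:
  assumes "right_module R M" shows "ring (endomorphism_ring R M)"
proof -
  interpret right_module R M by fact
  let ?S = "endomorphism_ring R M"
  have z0: "\<zero>\<^bsub>M\<^esub> \<bullet>\<^bsub>M\<^esub> a = \<zero>\<^bsub>M\<^esub>" if "a \<in> carrier R" for a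
    by (metis M.add.l_cancel_one' M.zero_closed M.l_zero rsmult_closed rsmult_l_distr that)
  have minus: "(\<ominus>\<^bsub>M\<^esub> x) \<bullet>\<^bsub>M\<^esub> a = \<ominus>\<^bsub>M\<^esub> (x \<bullet>\<^bsub>M\<^esub> a)" if "x \<in> carrier M" "a \<in> carrier R" for x a
    by (metis M.add.inv_closed M.l_neg M.minus_equality rsmult_closed rsmult_l_distr that z0)
  show ?thesis
  proof (rule ringI)
    show "abelian_group ?S"
    proof (rule abelian_groupI)
      fix f assume f: "f \<in> carrier ?S"
      have "(\<lambda>x\<in>carrier M. \<ominus>\<^bsub>M\<^esub> f x) \<in> carrier ?S"
        using f by (auto simp: endomorphism_ring_def PiE_iff minus rsmult_closed M.minus_add)
      moreover have "(\<lambda>x\<in>carrier M. \<ominus>\<^bsub>M\<^esub> f x) \<oplus>\<^bsub>?S\<^esub> f = \<zero>\<^bsub>?S\<^esub>"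
        using f by (auto simp: endomorphism_ring_def PiE_iff M.l_neg intro!: restrict_ext)
      ultimately show "\<exists>g\<in>carrier ?S. g \<oplus>\<^bsub>?S\<^esub> f = \<zero>\<^bsub>?S\<^esub>" by blast
    qed (auto simp: endomorphism_ring_def PiE_iff z0 rsmult_closed rsmult_l_distr M.a_ac
          intro!: restrict_ext extensionalityI[where A = "carrier M"])
  next
    show "Group.monoid ?S"
      by (rule monoidI) (auto simp: endomorphism_ring_def PiE_iff rsmult_closed
          intro!: extensionalityI[where A = "carrier M"])
  qed (auto simp: endomorphism_ring_def PiE_iff intro!: extensionalityI[where A = "carrier M"])
qed


section \<open>Adequacy of the definition of purity\<close>

lemma tensor_kernel_rel: "x \<in> tensor_relators R M L \<Longrightarrow> x \<in> tensor_kernel R M L"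
  by (simp add: tensor_kernel_def generate.incl)

lemma tensor_relators_cases:
  assumes "x \<in> tensor_relators R M L"
  obtains
    (1) m n l where "m \<in> carrier M" "n \<in> carrier M" "l \<in> carrier L"
      "x = frag_of (m \<oplus>\<^bsub>M\<^esub> n, l) - frag_of (m, l) - frag_of (n, l)"
  | (2) m l k where "m \<in> carrier M" "l \<in> carrier L" "k \<in> carrier L"
      "x = frag_of (m, l \<oplus>\<^bsub>L\<^esub> k) - frag_of (m, l) - frag_of (m, k)"
  | (3) m a l where "m \<in> carrier M" "a \<in> carrier R" "l \<in> carrier L"
      "x = frag_of (m \<bullet>\<^bsub>M\<^esub> a, l) - frag_of (m, a \<odot>\<^bsub>L\<^esub> l)"
proof -
  from assms consider
    "x \<in> {frag_of (x \<oplus>\<^bsub>M\<^esub> y, l) - frag_of (x, l) - frag_of (y, l) | x y l.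
       x \<in> carrier M \<and> y \<in> carrier M \<and> l \<in> carrier L}"
  | "x \<in> {frag_of (x, l \<oplus>\<^bsub>L\<^esub> k) - frag_of (x, l) - frag_of (x, k) | x l k.
       x \<in> carrier M \<and> l \<in> carrier L \<and> k \<in> carrier L}"
  | "x \<in> {frag_of (x \<bullet>\<^bsub>M\<^esub> a, l) - frag_of (x, a \<odot>\<^bsub>L\<^esub> l) | x a l.
       x \<in> carrier M \<and> a \<in> carrier R \<and> l \<in> carrier L}"
    unfolding tensor_relators_def by (elim UnE)
  then show ?thesis
  proof cases
    case 1
    then show ?thesis by (elim CollectE exE conjE) (rule that(1))
  next
    case 2
    then show ?thesis by (elim CollectE exE conjE) (rule that(2))
  next
    case 3
    then show ?thesis by (elim CollectE exE conjE) (rule that(3))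
  qed
qed

lemma tensor_kernel_keys:
  fixes R :: "('r, 'x) ring_scheme" and M :: "('r, 'm, 'y) right_module_scheme"
    and L :: "('r, 'l, 'z) module_scheme"
  assumes "right_module R M" "left_module R L" "x \<in> tensor_kernel R M L"
  shows "Poly_Mapping.keys x \<subseteq> carrier M \<times> carrier L"
proof -
  interpret M: right_module R M by fact
  interpret L: left_module R L by fact
  have k2: "Poly_Mapping.keys (frag_of p - frag_of q) \<subseteq> {p, q}" for p q :: "'m \<times> 'l"
    using keys_diff [of "frag_of p" "frag_of q"] by (simp add: insert_commute)
  have k3: "Poly_Mapping.keys (frag_of p - frag_of q - frag_of r) \<subseteq> {p, q, r}"
    for p q r :: "'m \<times> 'l"
    using keys_diff [of "frag_of p - frag_of q" "frag_of r"] k2 [of p q] by auto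
  have rel: "tensor_relators R M L \<subseteq> carrier (free_Abelian_group (carrier M \<times> carrier L))"
  proof
    fix h assume h: "h \<in> tensor_relators R M L"
    have "Poly_Mapping.keys h \<subseteq> carrier M \<times> carrier L"
      using h
    proof (cases rule: tensor_relators_cases)
      case (1 m n l)
      show ?thesis unfolding 1(4) by (rule order_trans [OF k3]) (use 1(1-3) in simp)
    next
      case (2 m l k)
      show ?thesis unfolding 2(4) by (rule order_trans [OF k3]) (use 2(1-3) in simp)
    next
      case (3 m a l)
      show ?thesis unfolding 3(4)
        by (rule order_trans [OF k2]) (use 3(1-3) in \<open>simp add: M.rsmult_closed L.smult_closed\<close>)
    qed
    then show "h \<in> carrier (free_Abelian_group (carrier M \<times> carrier L))" by simp
  qed
  have "tensor_kernel R M L \<subseteq> carrier (free_Abelian_group (carrier M \<times> carrier L))"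
    unfolding tensor_kernel_def
    by (rule group.generate_incl [OF group_free_Abelian_group rel])
  from subsetD [OF this assms(3)] show ?thesis by simp
qed

lemma subgroup_tensor_kernel:
  assumes "right_module R M" "left_module R L"
  shows "subgroup (tensor_kernel R M L) (free_Abelian_group (carrier M \<times> carrier L))"
proof -
  have "tensor_relators R M L \<subseteq> carrier (free_Abelian_group (carrier M \<times> carrier L))"
    using tensor_kernel_keys [OF assms tensor_kernel_rel] by (simp add: subset_eq)
  then show ?thesis
    unfolding tensor_kernel_def
    by (rule group.generate_is_subgroup [OF group_free_Abelian_group])
qed

lemma tensor_kernel_induct [consumes 3, case_names zero rel minus add]:
  assumes "right_module R M" "left_module R L" "x \<in> tensor_kernel R M L"
    and "P 0" "\<And>x. x \<in> tensor_relators R M L \<Longrightarrow> P x"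
    and "\<And>x. P x \<Longrightarrow> P (- x)" "\<And>x y. P x \<Longrightarrow> P y \<Longrightarrow> P (x + y)"
  shows "P x"
proof -
  have *: "Poly_Mapping.keys h \<subseteq> carrier M \<times> carrier L" if "h \<in> tensor_relators R M L" for h
    using tensor_kernel_keys [OF assms(1,2) tensor_kernel_rel [OF that]] .
  show ?thesis
    using assms(3) unfolding tensor_kernel_def
    by (induction rule: generate.induct) (auto simp: * assms(4-))
qed

lemma tensor_kernel_zero: "0 \<in> tensor_kernel R M L"
  using generate.one [of "free_Abelian_group (carrier M \<times> carrier L)" "tensor_relators R M L"]
  by (simp add: tensor_kernel_def)

lemma tensor_kernel_add:
  "x \<in> tensor_kernel R M L \<Longrightarrow> y \<in> tensor_kernel R M L \<Longrightarrow> x + y \<in> tensor_kernel R M L"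
  using generate.eng [of x "free_Abelian_group (carrier M \<times> carrier L)" "tensor_relators R M L" y]
  by (simp add: tensor_kernel_def)

lemma tensor_kernel_minus:
  assumes "right_module R M" "left_module R L" "x \<in> tensor_kernel R M L"
  shows "- x \<in> tensor_kernel R M L"
  using subgroup.m_inv_closed [OF subgroup_tensor_kernel [OF assms(1,2)] assms(3)]
    tensor_kernel_keys [OF assms] by simp

lemma tensor_kernel_diff:
  assumes "right_module R M" "left_module R L" "x \<in> tensor_kernel R M L" "y \<in> tensor_kernel R M L"
  shows "x - y \<in> tensor_kernel R M L"
  using tensor_kernel_add [OF assms(3) tensor_kernel_minus [OF assms(1,2,4)]] by simp

lemma right_module_submodule:
  assumes "right_module R M" "right_submodule P R M"
  shows "right_module R (M\<lparr>carrier := P\<rparr>)"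
proof -
  interpret right_module R M by fact
  have P: "P \<subseteq> carrier M" "\<And>x y. x \<in> P \<Longrightarrow> y \<in> P \<Longrightarrow> x \<oplus>\<^bsub>M\<^esub> y \<in> P" "\<zero>\<^bsub>M\<^esub> \<in> P"
    "\<And>x. x \<in> P \<Longrightarrow> \<ominus>\<^bsub>M\<^esub> x \<in> P" "\<And>x a. x \<in> P \<Longrightarrow> a \<in> carrier R \<Longrightarrow> x \<bullet>\<^bsub>M\<^esub> a \<in> P"
    using assms(2) subgroup.subset subgroup.m_closed subgroup.one_closed subgroup.m_inv_closed
    unfolding right_submodule_def a_inv_def by fastforce+
  have "abelian_group (M\<lparr>carrier := P\<rparr>)"
  proof (rule abelian_groupI)
    fix x assume "x \<in> carrier (M\<lparr>carrier := P\<rparr>)"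
    then show "\<exists>y\<in>carrier (M\<lparr>carrier := P\<rparr>). y \<oplus>\<^bsub>M\<lparr>carrier := P\<rparr>\<^esub> x = \<zero>\<^bsub>M\<lparr>carrier := P\<rparr>\<^esub>"
      using P by (auto intro!: bexI [of _ "\<ominus>\<^bsub>M\<^esub> x"] M.l_neg)
  qed (use P in \<open>auto intro: M.a_assoc M.a_comm\<close>)
  then show ?thesis
    using P by (intro right_module.intro right_module_axioms.intro)
      (auto simp: rsmult_l_distr rsmult_r_distr rsmult_assoc rsmult_one subset_iff R.ring_axioms)
qed

lemma tensor_kernel_mono_right:
  assumes "right_module R M" "right_submodule P R M" "left_module R L"
  shows "tensor_kernel R (M\<lparr>carrier := P\<rparr>) L \<subseteq> tensor_kernel R M L"
proof
  fix x assume "x \<in> tensor_kernel R (M\<lparr>carrier := P\<rparr>) L"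
  with right_module_submodule [OF assms(1,2)] assms(3) show "x \<in> tensor_kernel R M L"
  proof (induction rule: tensor_kernel_induct)
    case (rel x)
    have "P \<subseteq> carrier M"
      using assms(2) subgroup.subset unfolding right_submodule_def by fastforce
    with rel have "x \<in> tensor_relators R M L"
      unfolding tensor_relators_def by simp blast
    then show ?case by (rule tensor_kernel_rel)
  qed (simp_all add: tensor_kernel_zero tensor_kernel_add tensor_kernel_minus [OF assms(1,3)])
qed

lemma mem_tensor_rcos_iff:
  "z \<in> tensor_kernel R M L #>\<^bsub>free_Abelian_group S\<^esub> x \<longleftrightarrow> z - x \<in> tensor_kernel R M L"
proof -
  have "z = k + x \<longleftrightarrow> z - x = k" for k by (auto simp: algebra_simps)
  then show ?thesis by (simp add: r_coset_def)
qed

lemma tensor_rcos_eq_iff: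
  assumes "right_module R M" "left_module R L"
  shows "tensor_kernel R M L #>\<^bsub>free_Abelian_group S\<^esub> x =
    tensor_kernel R M L #>\<^bsub>free_Abelian_group S\<^esub> y \<longleftrightarrow> x - y \<in> tensor_kernel R M L"
proof
  assume "tensor_kernel R M L #>\<^bsub>free_Abelian_group S\<^esub> x =
    tensor_kernel R M L #>\<^bsub>free_Abelian_group S\<^esub> y"
  moreover have "x \<in> tensor_kernel R M L #>\<^bsub>free_Abelian_group S\<^esub> x"
    by (simp add: mem_tensor_rcos_iff tensor_kernel_zero)
  ultimately show "x - y \<in> tensor_kernel R M L" by (simp add: mem_tensor_rcos_iff)
next
  assume d: "x - y \<in> tensor_kernel R M L"
  show "tensor_kernel R M L #>\<^bsub>free_Abelian_group S\<^esub> x =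
    tensor_kernel R M L #>\<^bsub>free_Abelian_group S\<^esub> y"
    unfolding set_eq_iff mem_tensor_rcos_iff
  proof (intro allI iffI)
    fix z assume "z - x \<in> tensor_kernel R M L"
    from tensor_kernel_add [OF this d] show "z - y \<in> tensor_kernel R M L" by simp
  next
    fix z assume "z - y \<in> tensor_kernel R M L"
    from tensor_kernel_diff [OF assms this d] show "z - x \<in> tensor_kernel R M L" by simp
  qed
qed

lemma tensor_inclusion_rcos:
  assumes "right_module R M" "right_submodule P R M" "left_module R L"
    and "Poly_Mapping.keys x \<subseteq> P \<times> carrier L"
  shows "tensor_inclusion R M L
      (tensor_kernel R (M\<lparr>carrier := P\<rparr>) L #>\<^bsub>free_Abelian_group (P \<times> carrier L)\<^esub> x) =
    tensor_kernel R M L #>\<^bsub>free_Abelian_group (carrier M \<times> carrier L)\<^esub> x"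
proof (rule Set.set_eqI)
  fix z
  let ?K = "tensor_kernel R M L" and ?K' = "tensor_kernel R (M\<lparr>carrier := P\<rparr>) L"
  have "z \<in> tensor_inclusion R M L (?K' #>\<^bsub>free_Abelian_group (P \<times> carrier L)\<^esub> x) \<longleftrightarrow>
      (\<exists>k\<in>?K. \<exists>u. u - x \<in> ?K' \<and> z = k + u)"
    by (simp add: tensor_inclusion_def set_mult_def mem_tensor_rcos_iff Bex_def)
  also have "\<dots> \<longleftrightarrow> z - x \<in> ?K"
  proof
    assume "\<exists>k\<in>?K. \<exists>u. u - x \<in> ?K' \<and> z = k + u"
    then obtain k u where k: "k \<in> ?K" "u - x \<in> ?K'" "z = k + u" by blast
    from k(2) have "u - x \<in> ?K" using tensor_kernel_mono_right [OF assms(1-3)] by blast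
    from tensor_kernel_add [OF k(1) this] show "z - x \<in> ?K" by (simp add: k(3) add_diff_eq)
  next
    assume "z - x \<in> ?K"
    moreover have "x - x \<in> ?K'" by (simp add: tensor_kernel_zero)
    moreover have "z = (z - x) + x" by simp
    ultimately show "\<exists>k\<in>?K. \<exists>u. u - x \<in> ?K' \<and> z = k + u" by blast
  qed
  finally show "z \<in> tensor_inclusion R M L (?K' #>\<^bsub>free_Abelian_group (P \<times> carrier L)\<^esub> x) \<longleftrightarrow>
      z \<in> ?K #>\<^bsub>free_Abelian_group (carrier M \<times> carrier L)\<^esub> x"
    by (simp add: mem_tensor_rcos_iff)
qed

lemma inclusion_stays_injective_iff:
  fixes R :: "('r, 'x) ring_scheme" and M :: "('r, 'm, 'y) right_module_scheme"
    and L :: "('r, 'l, 'z) module_scheme"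
  assumes "right_module R M" "right_submodule P R M" "left_module R L"
  shows "inclusion_stays_injective P R M L \<longleftrightarrow>
    (\<forall>x. Poly_Mapping.keys x \<subseteq> P \<times> carrier L \<and> x \<in> tensor_kernel R M L \<longrightarrow>
      x \<in> tensor_kernel R (M\<lparr>carrier := P\<rparr>) L)"
    (is "?inj \<longleftrightarrow> ?ker")
proof -
  let ?P = "M\<lparr>carrier := P\<rparr>" and ?F = "free_Abelian_group (P \<times> carrier L)"
    and ?G = "free_Abelian_group (carrier M \<times> carrier L)"
  note mP = right_module_submodule [OF assms(1,2)]
  note incl = tensor_inclusion_rcos [OF assms]
  have carr: "carrier (tensor_product R ?P L) =
      (\<lambda>x. tensor_kernel R ?P L #>\<^bsub>?F\<^esub> x) ` {x. Poly_Mapping.keys x \<subseteq> P \<times> carrier L}"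
    by (auto simp: tensor_product_def FactGroup_def RCOSETS_def)
  note eqP = tensor_rcos_eq_iff [OF mP assms(3)] and eqM = tensor_rcos_eq_iff [OF assms(1,3)]
  have "?inj \<longleftrightarrow> (\<forall>x y. Poly_Mapping.keys x \<subseteq> P \<times> carrier L \<longrightarrow>
      Poly_Mapping.keys y \<subseteq> P \<times> carrier L \<longrightarrow>
      x - y \<in> tensor_kernel R M L \<longrightarrow> x - y \<in> tensor_kernel R ?P L)"
    unfolding inclusion_stays_injective_def carr inj_on_def by (auto simp: incl eqP eqM)
  also have "\<dots> \<longleftrightarrow> ?ker"
  proof (intro iffI allI impI)
    fix x assume L: "\<forall>x y. Poly_Mapping.keys x \<subseteq> P \<times> carrier L \<longrightarrow>
      Poly_Mapping.keys y \<subseteq> P \<times> carrier L \<longrightarrow>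
      x - y \<in> tensor_kernel R M L \<longrightarrow> x - y \<in> tensor_kernel R ?P L"
      and "Poly_Mapping.keys x \<subseteq> P \<times> carrier L \<and> x \<in> tensor_kernel R M L"
    then show "x \<in> tensor_kernel R ?P L" using L [rule_format, of x 0] by simp
  next
    fix x y :: "'m \<times> 'l \<Rightarrow>\<^sub>0 int"
    assume "?ker" "Poly_Mapping.keys x \<subseteq> P \<times> carrier L" "Poly_Mapping.keys y \<subseteq> P \<times> carrier L"
      "x - y \<in> tensor_kernel R M L"
    moreover from this(2,3) have "Poly_Mapping.keys (x - y) \<subseteq> P \<times> carrier L"
      using keys_diff [of x y] by blast
    ultimately show "x - y \<in> tensor_kernel R ?P L" by blast
  qed
  finally show ?thesis .
qed

lemma tensor_kernel_map:
  assumes "right_module R M" "left_module R L" "left_module R L'"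
    and \<phi>: "\<And>l. l \<in> carrier L \<Longrightarrow> \<phi> l \<in> carrier L'"
      "\<And>l k. l \<in> carrier L \<Longrightarrow> k \<in> carrier L \<Longrightarrow> \<phi> (l \<oplus>\<^bsub>L\<^esub> k) = \<phi> l \<oplus>\<^bsub>L'\<^esub> \<phi> k"
      "\<And>a l. a \<in> carrier R \<Longrightarrow> l \<in> carrier L \<Longrightarrow> \<phi> (a \<odot>\<^bsub>L\<^esub> l) = a \<odot>\<^bsub>L'\<^esub> \<phi> l"
    and "x \<in> tensor_kernel R M L"
  shows "frag_extend (frag_of \<circ> map_prod id \<phi>) x \<in> tensor_kernel R M L'"
  using assms(1,2,7)
proof (induction rule: tensor_kernel_induct)
  case (rel x)
  then have "frag_extend (frag_of \<circ> map_prod id \<phi>) x \<in> tensor_relators R M L'"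
    unfolding tensor_relators_def
    by (elim UnE CollectE exE conjE; simp add: frag_extend_diff \<phi>) (use \<phi>(1) in blast)+
  then show ?case by (rule tensor_kernel_rel)
qed (simp_all add: frag_extend_add frag_extend_minus tensor_kernel_zero tensor_kernel_add
    tensor_kernel_minus [OF assms(1,3)])

definition left_submodule :: "'l set \<Rightarrow> ('r, 'x) ring_scheme \<Rightarrow> ('r, 'l, 'z) module_scheme \<Rightarrow> bool"
  where "left_submodule N R L \<longleftrightarrow> N \<subseteq> carrier L \<and> \<zero>\<^bsub>L\<^esub> \<in> N \<and>
    (\<forall>x\<in>N. \<forall>y\<in>N. x \<oplus>\<^bsub>L\<^esub> y \<in> N) \<and> (\<forall>a\<in>carrier R. \<forall>x\<in>N. a \<odot>\<^bsub>L\<^esub> x \<in> N)"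

lemma (in left_module) minus_one_smult:
  assumes "x \<in> carrier L"
  shows "(\<ominus>\<^bsub>R\<^esub> \<one>\<^bsub>R\<^esub>) \<odot>\<^bsub>L\<^esub> x \<oplus>\<^bsub>L\<^esub> x = \<zero>\<^bsub>L\<^esub>"
proof -
  have z: "\<zero>\<^bsub>R\<^esub> \<odot>\<^bsub>L\<^esub> x = \<zero>\<^bsub>L\<^esub>"
    by (metis L.add.l_cancel_one' R.zero_closed R.l_zero assms smult_closed smult_l_distr)
  then show ?thesis
    by (metis R.add.inv_closed R.l_neg R.one_closed assms smult_l_distr smult_one)
qed

lemma left_module_submodule:
  assumes "left_module R L" "left_submodule N R L"
  shows "left_module R (L\<lparr>carrier := N\<rparr>)"
proof -
  interpret left_module R L by fact
  have N: "\<And>x. x \<in> N \<Longrightarrow> x \<in> carrier L" "\<And>x y. x \<in> N \<Longrightarrow> y \<in> N \<Longrightarrow> x \<oplus>\<^bsub>L\<^esub> y \<in> N"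
    "\<zero>\<^bsub>L\<^esub> \<in> N" "\<And>a x. a \<in> carrier R \<Longrightarrow> x \<in> N \<Longrightarrow> a \<odot>\<^bsub>L\<^esub> x \<in> N"
    using assms(2) by (auto simp: left_submodule_def)
  have "abelian_group (L\<lparr>carrier := N\<rparr>)"
  proof (rule abelian_groupI)
    fix x assume "x \<in> carrier (L\<lparr>carrier := N\<rparr>)"
    then show "\<exists>y\<in>carrier (L\<lparr>carrier := N\<rparr>). y \<oplus>\<^bsub>L\<lparr>carrier := N\<rparr>\<^esub> x = \<zero>\<^bsub>L\<lparr>carrier := N\<rparr>\<^esub>"
      using N by (auto intro!: bexI [of _ "(\<ominus>\<^bsub>R\<^esub> \<one>\<^bsub>R\<^esub>) \<odot>\<^bsub>L\<^esub> x"] minus_one_smult)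
  qed (use N in \<open>auto intro: L.a_assoc L.a_comm\<close>)
  then show ?thesis
    using N by (intro left_module.intro left_module_axioms.intro)
      (auto simp: smult_l_distr smult_r_distr smult_assoc smult_one R.ring_axioms)
qed

lemma tensor_relators_intros:
  "\<lbrakk>x \<in> carrier M; y \<in> carrier M; l \<in> carrier L\<rbrakk> \<Longrightarrow>
    frag_of (x \<oplus>\<^bsub>M\<^esub> y, l) - frag_of (x, l) - frag_of (y, l) \<in> tensor_relators R M L"
  "\<lbrakk>x \<in> carrier M; l \<in> carrier L; k \<in> carrier L\<rbrakk> \<Longrightarrow>
    frag_of (x, l \<oplus>\<^bsub>L\<^esub> k) - frag_of (x, l) - frag_of (x, k) \<in> tensor_relators R M L"
  "\<lbrakk>x \<in> carrier M; a \<in> carrier R; l \<in> carrier L\<rbrakk> \<Longrightarrow>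
    frag_of (x \<bullet>\<^bsub>M\<^esub> a, l) - frag_of (x, a \<odot>\<^bsub>L\<^esub> l) \<in> tensor_relators R M L"
  unfolding tensor_relators_def by blast+

lemma tensor_kernel_finite_support:
  assumes "right_module R M" "left_module R L" "x \<in> tensor_kernel R M L"
  obtains A where "finite A" "A \<subseteq> carrier L"
    "\<forall>N. left_submodule N R L \<longrightarrow> A \<subseteq> N \<longrightarrow> x \<in> tensor_kernel R M (L\<lparr>carrier := N\<rparr>)"
proof -
  define supp where "supp A x \<longleftrightarrow> finite A \<and> A \<subseteq> carrier L \<and>
    (\<forall>N. left_submodule N R L \<longrightarrow> A \<subseteq> N \<longrightarrow> x \<in> tensor_kernel R M (L\<lparr>carrier := N\<rparr>))" for A x
  have "\<exists>A. supp A x"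
    using assms
  proof (induction rule: tensor_kernel_induct)
    case zero
    have "supp {} 0" by (simp add: supp_def tensor_kernel_zero)
    then show ?case ..
  next
    case (rel x)
    then show ?case
    proof (cases rule: tensor_relators_cases)
      case (1 m n l)
      have "x \<in> tensor_kernel R M (L\<lparr>carrier := N\<rparr>)" if "{l} \<subseteq> N" for N
        using tensor_relators_intros(1) [of m M n l "L\<lparr>carrier := N\<rparr>" R] 1 that
        by (simp add: tensor_kernel_rel)
      with 1 have "supp {l} x" by (simp add: supp_def)
      then show ?thesis ..
    next
      case (2 m l k)
      have "x \<in> tensor_kernel R M (L\<lparr>carrier := N\<rparr>)" if "{l, k} \<subseteq> N" for N
        using tensor_relators_intros(2) [of m M l "L\<lparr>carrier := N\<rparr>" k R] 2 that
        by (simp add: tensor_kernel_rel)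
      with 2 have "supp {l, k} x" by (simp add: supp_def)
      then show ?thesis ..
    next
      case (3 m a l)
      have "x \<in> tensor_kernel R M (L\<lparr>carrier := N\<rparr>)" if "{l} \<subseteq> N" for N
        using tensor_relators_intros(3) [of m M a R l "L\<lparr>carrier := N\<rparr>"] 3 that
        by (simp add: tensor_kernel_rel)
      with 3 have "supp {l} x" by (simp add: supp_def)
      then show ?thesis ..
    qed
  next
    case (minus x)
    then obtain A where "supp A x" ..
    then have "supp A (- x)"
      using tensor_kernel_minus [OF assms(1) left_module_submodule [OF assms(2)]]
      by (simp add: supp_def)
    then show ?case ..
  next
    case (add x y)
    then obtain A B where "supp A x" "supp B y" by (elim exE)
    then have "supp (A \<union> B) (x + y)"
      by (simp add: supp_def tensor_kernel_add)
    then show ?case ..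
  qed
  then obtain A where "supp A x" ..
  then show ?thesis using that [of A] by (simp add: supp_def)
qed

lemma finite_subset_submodule:
  fixes R :: "('r, 'x) ring_scheme" and L :: "('r, 'l, 'z) module_scheme"
  assumes "left_module R L" "finite A" "A \<subseteq> carrier L"
  shows "\<exists>N (g :: 'r list \<Rightarrow> 'l). left_submodule N R L \<and> A \<subseteq> N \<and> N \<subseteq> range g"
proof -
  interpret left_module R L by fact
  show ?thesis
    using assms(2,3)
  proof (induction rule: finite_induct)
    case empty
    have "a \<odot>\<^bsub>L\<^esub> \<zero>\<^bsub>L\<^esub> = \<zero>\<^bsub>L\<^esub>" if "a \<in> carrier R" for a
      by (metis L.add.l_cancel_one' L.zero_closed L.l_zero smult_closed smult_r_distr that)
    then show ?case
      by (intro exI [of _ "{\<zero>\<^bsub>L\<^esub>}"] exI [of _ "\<lambda>_. \<zero>\<^bsub>L\<^esub>"]) (auto simp: left_submodule_def)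
  next
    case (insert b A)
    then obtain N and g :: "'r list \<Rightarrow> 'l"
      where N: "left_submodule N R L" "A \<subseteq> N" "N \<subseteq> range g" by auto
    have b: "b \<in> carrier L" using insert by simp
    have NL: "\<And>n. n \<in> N \<Longrightarrow> n \<in> carrier L" and N0: "\<zero>\<^bsub>L\<^esub> \<in> N"
      and Na: "\<And>n m. n \<in> N \<Longrightarrow> m \<in> N \<Longrightarrow> n \<oplus>\<^bsub>L\<^esub> m \<in> N"
      and Ns: "\<And>a n. a \<in> carrier R \<Longrightarrow> n \<in> N \<Longrightarrow> a \<odot>\<^bsub>L\<^esub> n \<in> N"
      using N(1) by (auto simp: left_submodule_def)
    define N' where "N' = {n \<oplus>\<^bsub>L\<^esub> a \<odot>\<^bsub>L\<^esub> b | n a. n \<in> N \<and> a \<in> carrier R}"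
    define g' where "g' = (\<lambda>as. g (tl as) \<oplus>\<^bsub>L\<^esub> hd as \<odot>\<^bsub>L\<^esub> b)"
    have b0: "\<zero>\<^bsub>R\<^esub> \<odot>\<^bsub>L\<^esub> b = \<zero>\<^bsub>L\<^esub>"
      by (metis L.add.l_cancel_one' R.zero_closed R.l_zero b smult_closed smult_l_distr)
    have NN': "n \<in> N'" if "n \<in> N" for n
    proof -
      have "n = n \<oplus>\<^bsub>L\<^esub> \<zero>\<^bsub>R\<^esub> \<odot>\<^bsub>L\<^esub> b" using that NL b0 by simp
      then show ?thesis unfolding N'_def using that by blast
    qed
    have "b = \<zero>\<^bsub>L\<^esub> \<oplus>\<^bsub>L\<^esub> \<one>\<^bsub>R\<^esub> \<odot>\<^bsub>L\<^esub> b" using b smult_one by simp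
    then have bN': "b \<in> N'" unfolding N'_def using N0 by blast
    have "left_submodule N' R L"
      unfolding left_submodule_def
    proof (intro conjI ballI)
      show "N' \<subseteq> carrier L" using NL b by (auto simp: N'_def smult_closed)
      show "\<zero>\<^bsub>L\<^esub> \<in> N'" using NN' N0 by blast
    next
      fix x y assume "x \<in> N'" "y \<in> N'"
      then obtain n a m c where *: "n \<in> N" "a \<in> carrier R" "m \<in> N" "c \<in> carrier R"
        "x = n \<oplus>\<^bsub>L\<^esub> a \<odot>\<^bsub>L\<^esub> b" "y = m \<oplus>\<^bsub>L\<^esub> c \<odot>\<^bsub>L\<^esub> b" by (auto simp: N'_def)
      then have "x \<oplus>\<^bsub>L\<^esub> y = (n \<oplus>\<^bsub>L\<^esub> m) \<oplus>\<^bsub>L\<^esub> (a \<oplus>\<^bsub>R\<^esub> c) \<odot>\<^bsub>L\<^esub> b"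
        using NL b by (simp add: smult_l_distr smult_closed L.a_ac)
      then show "x \<oplus>\<^bsub>L\<^esub> y \<in> N'" unfolding N'_def using * Na by blast
    next
      fix c x assume "c \<in> carrier R" "x \<in> N'"
      then obtain n a where *: "n \<in> N" "a \<in> carrier R" "c \<in> carrier R"
        "x = n \<oplus>\<^bsub>L\<^esub> a \<odot>\<^bsub>L\<^esub> b" by (auto simp: N'_def)
      then have "c \<odot>\<^bsub>L\<^esub> x = c \<odot>\<^bsub>L\<^esub> n \<oplus>\<^bsub>L\<^esub> (c \<otimes>\<^bsub>R\<^esub> a) \<odot>\<^bsub>L\<^esub> b"
        using NL b by (simp add: smult_r_distr smult_closed smult_assoc)
      then show "c \<odot>\<^bsub>L\<^esub> x \<in> N'" unfolding N'_def using * Ns by blast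
    qed
    moreover have "N' \<subseteq> range g'"
    proof
      fix x assume "x \<in> N'"
      then obtain n a where "n \<in> N" "x = n \<oplus>\<^bsub>L\<^esub> a \<odot>\<^bsub>L\<^esub> b" by (auto simp: N'_def)
      moreover obtain as where "n = g as" using N(3) \<open>n \<in> N\<close> by blast
      ultimately have "x = g' (a # as)" by (simp add: g'_def)
      then show "x \<in> range g'" by blast
    qed
    ultimately show ?case using NN' bN' N(2) by blast
  qed
qed

lemma pure_imp_injective:
  fixes R :: "('r, 'x) ring_scheme" and M :: "('r, 'm, 'y) right_module_scheme"
    and L :: "('r, 'l, 'z) module_scheme"
  assumes "right_module R M" "pure_submodule P R M" "left_module R L"
  shows "inclusion_stays_injective P R M L"
proof -
  interpret L: left_module R L by fact
  have P: "right_submodule P R M" using assms(2) by (simp add: pure_submodule_def)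
  let ?P = "M\<lparr>carrier := P\<rparr>"
  note mP = right_module_submodule [OF assms(1) P]
  have "x \<in> tensor_kernel R ?P L"
    if keys: "Poly_Mapping.keys x \<subseteq> P \<times> carrier L" and x: "x \<in> tensor_kernel R M L" for x
  proof -
    obtain A where A: "finite A" "A \<subseteq> carrier L"
      "\<forall>N. left_submodule N R L \<longrightarrow> A \<subseteq> N \<longrightarrow> x \<in> tensor_kernel R M (L\<lparr>carrier := N\<rparr>)"
      by (rule tensor_kernel_finite_support [OF assms(1,3) x])
    have "snd ` Poly_Mapping.keys x \<subseteq> carrier L"
      by (rule image_subsetI, drule subsetD [OF keys]) (simp add: mem_Times_iff)
    then have fin: "finite (A \<union> snd ` Poly_Mapping.keys x)" "A \<union> snd ` Poly_Mapping.keys x \<subseteq> carrier L"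
      using A(1,2) by simp_all
    then obtain N and g :: "'r list \<Rightarrow> 'l" where N: "left_submodule N R L"
      "A \<union> snd ` Poly_Mapping.keys x \<subseteq> N" "N \<subseteq> range g"
      using finite_subset_submodule [OF assms(3) fin] by (elim exE conjE)
    let ?N = "L\<lparr>carrier := N\<rparr>"
    note mN = left_module_submodule [OF assms(3) N(1)]
    interpret N: left_module R ?N by (rule mN)
    have NL: "N \<subseteq> carrier L" using N(1) by (simp add: left_submodule_def)
    have xN: "x \<in> tensor_kernel R M ?N" using A(3) N(1,2) by simp
    have keysN: "Poly_Mapping.keys x \<subseteq> P \<times> N" 
    proof
      fix p assume p: "p \<in> Poly_Mapping.keys x"
      then have "snd p \<in> N" using N(2) by (simp add: image_subset_iff)
      with subsetD [OF keys p] show "p \<in> P \<times> N" by (simp add: mem_Times_iff)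
    qed
    define \<psi> where "\<psi> = (\<lambda>l. {as. g as = l})"
    have inj: "inj_on \<psi> N" using N(3) by (force simp: inj_on_def \<psi>_def)
    define \<chi> where "\<chi> = inv_into N \<psi>"
    have \<chi>\<psi>: "\<chi> (\<psi> l) = l" if "l \<in> N" for l
      using inj that by (simp add: \<chi>_def)
    define C :: "('r, 'r list set) module" where "C =
      \<lparr>carrier = \<psi> ` N, monoid.mult = undefined, one = undefined, ring.zero = \<psi> \<zero>\<^bsub>L\<^esub>,
       ring.add = (\<lambda>u v. \<psi> (\<chi> u \<oplus>\<^bsub>L\<^esub> \<chi> v)), smult = (\<lambda>a u. \<psi> (a \<odot>\<^bsub>L\<^esub> \<chi> u))\<rparr>"
    have C: "carrier C = \<psi> ` N" "\<zero>\<^bsub>C\<^esub> = \<psi> \<zero>\<^bsub>L\<^esub>" "\<And>u v. u \<oplus>\<^bsub>C\<^esub> v = \<psi> (\<chi> u \<oplus>\<^bsub>L\<^esub> \<chi> v)"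
      "\<And>a u. a \<odot>\<^bsub>C\<^esub> u = \<psi> (a \<odot>\<^bsub>L\<^esub> \<chi> u)" by (simp_all add: C_def)
    have cl: "\<zero>\<^bsub>L\<^esub> \<in> N" "\<And>l k. l \<in> N \<Longrightarrow> k \<in> N \<Longrightarrow> l \<oplus>\<^bsub>L\<^esub> k \<in> N"
      "\<And>a l. a \<in> carrier R \<Longrightarrow> l \<in> N \<Longrightarrow> a \<odot>\<^bsub>L\<^esub> l \<in> N" "\<And>l. l \<in> N \<Longrightarrow> l \<in> carrier L"
      using N(1) by (auto simp: left_submodule_def)
    have "abelian_group C"
    proof (rule abelian_groupI)
      fix u assume "u \<in> carrier C"
      then obtain l where l: "l \<in> N" "u = \<psi> l" by (auto simp: C)
      show "\<exists>v\<in>carrier C. v \<oplus>\<^bsub>C\<^esub> u = \<zero>\<^bsub>C\<^esub>"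
        by (rule bexI [of _ "\<psi> ((\<ominus>\<^bsub>R\<^esub> \<one>\<^bsub>R\<^esub>) \<odot>\<^bsub>L\<^esub> l)"])
          (use l in \<open>simp_all add: C cl \<chi>\<psi> L.minus_one_smult\<close>)
    qed (auto simp: C cl \<chi>\<psi> L.a_ac)
    then have mC: "left_module R C"
      by (intro left_module.intro left_module_axioms.intro)
        (auto simp: C cl \<chi>\<psi> L.smult_l_distr L.smult_r_distr L.smult_assoc L.smult_one L.ring_axioms)
    let ?y = "frag_extend (frag_of \<circ> map_prod id \<psi>) x"
    have "?y \<in> tensor_kernel R M C"
      by (rule tensor_kernel_map [OF assms(1) mN mC _ _ _ xN]) (auto simp: C \<chi>\<psi>)
    moreover have "Poly_Mapping.keys ?y \<subseteq> P \<times> carrier C"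
    proof (rule order_trans [OF keys_frag_extend], rule UN_least)
      fix p assume "p \<in> Poly_Mapping.keys x"
      from subsetD [OF keysN this]
      show "Poly_Mapping.keys ((frag_of \<circ> map_prod id \<psi>) p) \<subseteq> P \<times> carrier C"
        by (auto simp: C)
    qed
    moreover have "inclusion_stays_injective P R M C"
      using assms(2) mC by (simp add: pure_submodule_def)
    ultimately have y: "?y \<in> tensor_kernel R ?P C"
      using inclusion_stays_injective_iff [OF assms(1) P mC] by simp
    have "frag_extend (frag_of \<circ> map_prod id \<chi>) ?y \<in> tensor_kernel R ?P L"
      by (rule tensor_kernel_map [OF mP mC assms(3) _ _ _ y]) (auto simp: C cl \<chi>\<psi>)
    also have "frag_extend (frag_of \<circ> map_prod id \<chi>) ?y
        = frag_extend (frag_of \<circ> map_prod id \<chi> \<circ> map_prod id \<psi>) x"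
      by (rule frag_extend_compose)
    also have "\<dots> = frag_extend frag_of x"
      by (rule frag_extend_eq) (use keysN \<chi>\<psi> in auto)
    also have "\<dots> = x" by (rule frag_expansion [symmetric])
    finally show ?thesis .
  qed
  then show ?thesis
    using inclusion_stays_injective_iff [OF assms(1) P assms(3)] by simp
qed

end

theory Submission
  imports Defs
begin

text \<open>Let \<open>M\<close> be centrally quasi-morphic.  For endomorphisms \<open>f\<close>, \<open>g\<close> one has
  \<open>Im f \<subseteq> Im g \<longleftrightarrow> ker g \<subseteq> ker f\<close>: each side says that the central map with image \<open>ker g\<close>,
  respectively with kernel \<open>Im g\<close>, annihilates \<open>f\<close>.  Given \<open>f = f\<^sub>0\<close>, choose central maps \<open>f\<^sub>1, f\<^sub>2, \<dots>\<close>
  with \<open>ker f\<^sub>n = Im f\<^sub>n\<^sub>+\<^sub>1\<close>.  Since \<open>f\<^sub>n\<close> and \<open>f\<^sub>n\<^sub>+\<^sub>1\<close> commute and have product zero,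
  \<open>Im f\<^sub>n \<subseteq> ker f\<^sub>n\<^sub>+\<^sub>1 = Im f\<^sub>n\<^sub>+\<^sub>2\<close>.  As \<open>M\<close> is noetherian, \<open>Im f\<^sub>n = Im f\<^sub>n\<^sub>+\<^sub>2\<close> for some \<open>n\<close>.
  By the equivalence an equality \<open>Im f\<^sub>n\<^sub>+\<^sub>1 = Im f\<^sub>n\<^sub>+\<^sub>3\<close>, that is \<open>ker f\<^sub>n = ker f\<^sub>n\<^sub>+\<^sub>2\<close>,
  implies \<open>Im f\<^sub>n = Im f\<^sub>n\<^sub>+\<^sub>2\<close>, so one descends to \<open>Im f = Im f\<^sub>2 = ker f\<^sub>1\<close>,
  while \<open>ker f = Im f\<^sub>1\<close>.\<close>

section \<open>Scalars and submodules of right modules\<close>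

lemma (in right_module) rsmult_zero:
  "a \<in> carrier R \<Longrightarrow> \<zero>\<^bsub>M\<^esub> \<bullet>\<^bsub>M\<^esub> a = \<zero>\<^bsub>M\<^esub>"
  by (metis M.add.l_cancel_one' M.zero_closed M.l_zero rsmult_closed rsmult_l_distr)

lemma (in right_module) rsmult_zero_right:
  "x \<in> carrier M \<Longrightarrow> x \<bullet>\<^bsub>M\<^esub> \<zero>\<^bsub>R\<^esub> = \<zero>\<^bsub>M\<^esub>"
  by (metis M.add.l_cancel_one' R.zero_closed R.l_zero rsmult_closed rsmult_r_distr)

lemma (in right_module) rsmult_minus_one:
  assumes "x \<in> carrier M" shows "x \<bullet>\<^bsub>M\<^esub> (\<ominus>\<^bsub>R\<^esub> \<one>\<^bsub>R\<^esub>) = \<ominus>\<^bsub>M\<^esub> x"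
proof -
  have "x \<bullet>\<^bsub>M\<^esub> (\<ominus>\<^bsub>R\<^esub> \<one>\<^bsub>R\<^esub>) \<oplus>\<^bsub>M\<^esub> x = x \<bullet>\<^bsub>M\<^esub> (\<ominus>\<^bsub>R\<^esub> \<one>\<^bsub>R\<^esub> \<oplus>\<^bsub>R\<^esub> \<one>\<^bsub>R\<^esub>)"
    using assms by (simp only: rsmult_r_distr rsmult_one R.add.inv_closed R.one_closed)
  also have "\<dots> = \<zero>\<^bsub>M\<^esub>" using assms by (simp add: R.l_neg rsmult_zero_right)
  finally show ?thesis using assms by (simp add: M.minus_equality rsmult_closed)
qed

text \<open>Closure under negation follows from closure under scalars, because \<open>-x\<close> is
  \<open>x\<close> times \<open>-1\<close>.\<close>

lemma (in right_module) right_submodule_iff: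
  "right_submodule N R M \<longleftrightarrow>
    N \<subseteq> carrier M \<and> \<zero>\<^bsub>M\<^esub> \<in> N \<and> (\<forall>x\<in>N. \<forall>y\<in>N. x \<oplus>\<^bsub>M\<^esub> y \<in> N) \<and>
    (\<forall>x\<in>N. \<forall>a\<in>carrier R. x \<bullet>\<^bsub>M\<^esub> a \<in> N)" (is "?l \<longleftrightarrow> ?r")
proof
  assume ?l
  then have "subgroup N (add_monoid M)" "\<forall>x\<in>N. \<forall>a\<in>carrier R. x \<bullet>\<^bsub>M\<^esub> a \<in> N"
    by (auto simp: right_submodule_def)
  then show ?r
    using subgroup.subset[of N "add_monoid M"] subgroup.one_closed[of N "add_monoid M"]
      subgroup.m_closed[of N "add_monoid M"] by simp
next
  assume r: ?r
  have "\<ominus>\<^bsub>M\<^esub> x \<in> N" if "x \<in> N" for x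
  proof -
    have "x \<bullet>\<^bsub>M\<^esub> (\<ominus>\<^bsub>R\<^esub> \<one>\<^bsub>R\<^esub>) \<in> N" "x \<in> carrier M" using that r by auto
    then show ?thesis by (simp add: rsmult_minus_one)
  qed
  then have "subgroup N (add_monoid M)"
    using r by (intro M.add.subgroupI) (auto simp: a_inv_def)
  with r show ?l by (simp add: right_submodule_def)
qed

lemma (in right_module) right_submodule_diff:
  assumes "right_submodule N R M" "x \<in> N" "y \<in> N"
  shows "x \<ominus>\<^bsub>M\<^esub> y \<in> N"
proof -
  have "y \<bullet>\<^bsub>M\<^esub> (\<ominus>\<^bsub>R\<^esub> \<one>\<^bsub>R\<^esub>) \<in> N" "y \<in> carrier M"
    using assms by (auto simp: right_submodule_iff)
  then have "\<ominus>\<^bsub>M\<^esub> y \<in> N" by (simp add: rsmult_minus_one)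
  then show ?thesis using assms by (simp add: right_submodule_iff a_minus_def)
qed

lemma (in right_module) right_submodule_UN_chain:
  assumes "\<And>i. right_submodule (U i) R M" "mono U"
  shows "right_submodule (\<Union>i::nat. U i) R M"
proof -
  have "x \<oplus>\<^bsub>M\<^esub> y \<in> (\<Union>i. U i)" if "x \<in> U i" "y \<in> U j" for x y i j
  proof -
    have "x \<in> U (max i j)" "y \<in> U (max i j)"
      using that monoD[OF \<open>mono U\<close>] max.cobounded1 max.cobounded2 by blast+
    then show ?thesis using assms(1)[of "max i j"] by (auto simp: right_submodule_iff)
  qed
  then show ?thesis
    using assms(1) unfolding right_submodule_iff by blast
qed

section \<open>Finitely generated modules over a right noetherian ring are noetherian\<close>

text \<open>The condition is relative to a subset \<open>N\<close> of a fixed \<open>M\<close>, so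
  that an induction over submodules never has to change the module record.\<close>

definition ascending_chain_condition ::
    "'m set \<Rightarrow> ('r, 'x) ring_scheme \<Rightarrow> ('r, 'm, 'y) right_module_scheme \<Rightarrow> bool"
  where "ascending_chain_condition N R M \<longleftrightarrow>
    (\<forall>U :: nat \<Rightarrow> 'm set. mono U \<longrightarrow> (\<forall>i. right_submodule (U i) R M \<and> U i \<subseteq> N) \<longrightarrow>
      (\<exists>n. \<forall>m\<ge>n. U m = U n))"

text \<open>The union of a chain is a submodule, hence finitely generated. Its finitely many
  generators already lie in one member of the chain, which therefore is the whole union.\<close>

lemma (in right_module) finitely_generated_imp_acc:
  assumes "\<And>N. right_submodule N R M \<Longrightarrow> \<exists>A \<subseteq> N. finite A \<and> right_span R M A = N"
  shows "ascending_chain_condition (carrier M) R M"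
  unfolding ascending_chain_condition_def
proof (intro allI impI)
  fix U :: "nat \<Rightarrow> 'm set"
  assume U: "mono U" "\<forall>i. right_submodule (U i) R M \<and> U i \<subseteq> carrier M"
  then obtain A where A: "A \<subseteq> (\<Union>i. U i)" "finite A" "right_span R M A = (\<Union>i. U i)"
    using assms[OF right_submodule_UN_chain, of U] by auto
  have "\<exists>n. A \<subseteq> U n"
    using A(2,1)
  proof (induction rule: finite_induct)
    case (insert x A)
    then obtain n k where "A \<subseteq> U n" "x \<in> U k" by auto
    then have "insert x A \<subseteq> U (max n k)"
      using monoD[OF U(1), of n "max n k"] monoD[OF U(1), of k "max n k"] by auto
    then show ?case ..
  qed auto
  then obtain n where "A \<subseteq> U n" ..
  then have "(\<Union>i. U i) \<subseteq> U n" using A(3) U(2) by (auto simp: right_span_def)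
  then have "U m = U n" if "m \<ge> n" for m using monoD[OF U(1) that] by blast
  then show "\<exists>n. \<forall>m\<ge>n. U m = U n" by blast
qed

text \<open>This makes the results on submodules available for right ideals.\<close>

lemma regular_right_module:
  assumes "ring R" shows "right_module R (regular_right_module R)"
proof -
  interpret ring R by fact
  have "abelian_group (regular_right_module R)"
  proof (rule abelian_groupI)
    fix x assume "x \<in> carrier (regular_right_module R)"
    then show "\<exists>y\<in>carrier (regular_right_module R).
        y \<oplus>\<^bsub>regular_right_module R\<^esub> x = \<zero>\<^bsub>regular_right_module R\<^esub>"
      by (intro bexI[of _ "\<ominus>\<^bsub>R\<^esub> x"]) (simp_all add: regular_right_module_def l_neg)
  qed (simp_all add: regular_right_module_def a_ac)
  then show ?thesis
    by (intro right_module.intro right_module_axioms.intro)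
      (auto simp: regular_right_module_def l_distr r_distr m_assoc ring_axioms)
qed

text \<open>Here \<open>K\<close> is \<open>N + xR\<close>. The usual argument through
  \<open>K/N\<close> is carried out without quotients: nested submodules of \<open>K\<close>
  coincide once they have the same intersection with \<open>N\<close> and the same right ideal of
  coefficients of \<open>x\<close> modulo \<open>N\<close>.\<close>

lemma (in right_module) acc_add_cyclic:
  assumes R: "right_noetherian R" and N: "right_submodule N R M"
    and acc: "ascending_chain_condition N R M" and x: "x \<in> carrier M"
  defines "K \<equiv> {n \<oplus>\<^bsub>M\<^esub> x \<bullet>\<^bsub>M\<^esub> a | n a. n \<in> N \<and> a \<in> carrier R}"
  shows "right_submodule K R M" "ascending_chain_condition K R M" "insert x N \<subseteq> K"
proof -
  let ?R = "regular_right_module R"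
  interpret RR: right_module R ?R by (rule regular_right_module[OF R.ring_axioms])
  have simps [simp]: "carrier ?R = carrier R" "\<zero>\<^bsub>?R\<^esub> = \<zero>\<^bsub>R\<^esub>" "a \<oplus>\<^bsub>?R\<^esub> b = a \<oplus>\<^bsub>R\<^esub> b"
    "a \<bullet>\<^bsub>?R\<^esub> b = a \<otimes>\<^bsub>R\<^esub> b" for a b
    by (simp_all add: regular_right_module_def)
  have N0: "\<zero>\<^bsub>M\<^esub> \<in> N" and NM: "\<And>n. n \<in> N \<Longrightarrow> n \<in> carrier M"
    and Na: "\<And>n k. n \<in> N \<Longrightarrow> k \<in> N \<Longrightarrow> n \<oplus>\<^bsub>M\<^esub> k \<in> N"
    and Ns: "\<And>n a. n \<in> N \<Longrightarrow> a \<in> carrier R \<Longrightarrow> n \<bullet>\<^bsub>M\<^esub> a \<in> N"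
    using N by (auto simp: right_submodule_iff)
  have add: "(n \<oplus>\<^bsub>M\<^esub> x \<bullet>\<^bsub>M\<^esub> a) \<oplus>\<^bsub>M\<^esub> (k \<oplus>\<^bsub>M\<^esub> x \<bullet>\<^bsub>M\<^esub> b) = (n \<oplus>\<^bsub>M\<^esub> k) \<oplus>\<^bsub>M\<^esub> x \<bullet>\<^bsub>M\<^esub> (a \<oplus>\<^bsub>R\<^esub> b)"
    if "n \<in> N" "k \<in> N" "a \<in> carrier R" "b \<in> carrier R" for n k a b
    using that NM x by (simp add: rsmult_r_distr rsmult_closed M.a_ac)
  have smult: "(n \<oplus>\<^bsub>M\<^esub> x \<bullet>\<^bsub>M\<^esub> a) \<bullet>\<^bsub>M\<^esub> b = n \<bullet>\<^bsub>M\<^esub> b \<oplus>\<^bsub>M\<^esub> x \<bullet>\<^bsub>M\<^esub> (a \<otimes>\<^bsub>R\<^esub> b)"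
    if "n \<in> N" "a \<in> carrier R" "b \<in> carrier R" for n a b
    using that NM x by (simp add: rsmult_l_distr rsmult_closed rsmult_assoc)
  show sub: "insert x N \<subseteq> K"
  proof -
    have "x = \<zero>\<^bsub>M\<^esub> \<oplus>\<^bsub>M\<^esub> x \<bullet>\<^bsub>M\<^esub> \<one>\<^bsub>R\<^esub>" using x by (simp add: rsmult_one)
    moreover have "n = n \<oplus>\<^bsub>M\<^esub> x \<bullet>\<^bsub>M\<^esub> \<zero>\<^bsub>R\<^esub>" if "n \<in> N" for n
      using x NM[OF that] by (simp add: rsmult_zero_right)
    ultimately show ?thesis unfolding K_def using N0 by blast
  qed
  show "right_submodule K R M"
    unfolding right_submodule_iff
  proof (intro conjI ballI)
    show "K \<subseteq> carrier M" using NM x by (auto simp: K_def rsmult_closed)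
    show "\<zero>\<^bsub>M\<^esub> \<in> K" using sub N0 by blast
  next
    fix u v assume "u \<in> K" "v \<in> K"
    then show "u \<oplus>\<^bsub>M\<^esub> v \<in> K" unfolding K_def
      by clarify (metis add Na R.add.m_closed)
  next
    fix u a assume "u \<in> K" "a \<in> carrier R"
    then show "u \<bullet>\<^bsub>M\<^esub> a \<in> K" unfolding K_def
      by clarify (metis smult Ns R.m_closed)
  qed
  have accR: "ascending_chain_condition (carrier ?R) R ?R"
    by (rule RR.finitely_generated_imp_acc) (use R in \<open>auto simp: right_noetherian_def\<close>)
  show "ascending_chain_condition K R M"
    unfolding ascending_chain_condition_def
  proof (intro allI impI)
    fix U :: "nat \<Rightarrow> 'm set"
    assume U: "mono U" "\<forall>i. right_submodule (U i) R M \<and> U i \<subseteq> K"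
    \<comment> \<open>\<open>I i\<close> is the preimage in \<open>R\<close> of the image of
      \<open>U i\<close> in \<open>K/N\<close>, under the map sending \<open>a\<close> to the class
      of \<open>xa\<close>.\<close>
    define I where "I i = {a \<in> carrier R. \<exists>n\<in>N. n \<oplus>\<^bsub>M\<^esub> x \<bullet>\<^bsub>M\<^esub> a \<in> U i}" for i
    have U0: "\<zero>\<^bsub>M\<^esub> \<in> U i" and Ua: "\<And>u v. u \<in> U i \<Longrightarrow> v \<in> U i \<Longrightarrow> u \<oplus>\<^bsub>M\<^esub> v \<in> U i"
      and Us: "\<And>u a. u \<in> U i \<Longrightarrow> a \<in> carrier R \<Longrightarrow> u \<bullet>\<^bsub>M\<^esub> a \<in> U i" for i
      using U(2)[rule_format, of i] by (auto simp: right_submodule_iff)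
    have "right_submodule (I i) R ?R" for i
      unfolding RR.right_submodule_iff
    proof (intro conjI ballI)
      show "I i \<subseteq> carrier ?R" by (auto simp: I_def)
      have "\<zero>\<^bsub>M\<^esub> \<oplus>\<^bsub>M\<^esub> x \<bullet>\<^bsub>M\<^esub> \<zero>\<^bsub>R\<^esub> \<in> U i" using U0 x by (simp add: rsmult_zero_right)
      then show "\<zero>\<^bsub>?R\<^esub> \<in> I i" using N0 by (auto simp: I_def)
    next
      fix a b assume "a \<in> I i" "b \<in> I i"
      then obtain n k where *: "a \<in> carrier R" "b \<in> carrier R" "n \<in> N" "k \<in> N"
        "n \<oplus>\<^bsub>M\<^esub> x \<bullet>\<^bsub>M\<^esub> a \<in> U i" "k \<oplus>\<^bsub>M\<^esub> x \<bullet>\<^bsub>M\<^esub> b \<in> U i" by (auto simp: I_def)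
      then show "a \<oplus>\<^bsub>?R\<^esub> b \<in> I i"
        using Ua[OF *(5,6)] Na[OF *(3,4)] by (auto simp: I_def add)
    next
      fix a b assume "a \<in> I i" and b: "b \<in> carrier R"
      then obtain n where *: "a \<in> carrier R" "n \<in> N" "n \<oplus>\<^bsub>M\<^esub> x \<bullet>\<^bsub>M\<^esub> a \<in> U i"
        by (auto simp: I_def)
      then show "a \<bullet>\<^bsub>?R\<^esub> b \<in> I i"
        using Us[OF *(3) b] Ns[OF *(2) b] b by (auto simp: I_def smult)
    qed
    moreover have "mono I" using U(1) by (force simp: mono_def I_def)
    moreover have "I i \<subseteq> carrier ?R" for i by (auto simp: I_def)
    ultimately have "\<exists>p. \<forall>m\<ge>p. I m = I p"
      using accR unfolding ascending_chain_condition_def by blast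
    then obtain p where p: "\<And>m. m \<ge> p \<Longrightarrow> I m = I p" by blast
    have "right_submodule (U i \<inter> N) R M" for i
      using U(2)[rule_format, of i] N by (auto simp: right_submodule_iff)
    moreover have "mono (\<lambda>i. U i \<inter> N)" using U(1) by (force simp: mono_def)
    ultimately have "\<exists>q. \<forall>m\<ge>q. U m \<inter> N = U q \<inter> N"
      using acc[unfolded ascending_chain_condition_def, rule_format, of "\<lambda>i. U i \<inter> N"] by blast
    then obtain q where q: "\<And>m. m \<ge> q \<Longrightarrow> U m \<inter> N = U q \<inter> N" by blast
    \<comment> \<open>Past \<open>max p q\<close> both auxiliary chains are constant. An element
      \<open>n + xa\<close> of \<open>U m\<close> is compared with some \<open>k + xa\<close> in
      \<open>U (max p q)\<close>; the difference \<open>n - k\<close> lies in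
      \<open>U m \<inter> N\<close>, hence already in \<open>U (max p q)\<close>.\<close>
    have "U m = U (max p q)" if "m \<ge> max p q" for m
    proof
      show "U (max p q) \<subseteq> U m" by (rule monoD[OF U(1) that])
      show "U m \<subseteq> U (max p q)"
      proof
        fix u assume u: "u \<in> U m"
        then obtain n a where na: "n \<in> N" "a \<in> carrier R" "u = n \<oplus>\<^bsub>M\<^esub> x \<bullet>\<^bsub>M\<^esub> a"
          using U(2) unfolding K_def by blast
        then have "a \<in> I m" using u by (auto simp: I_def)
        moreover have "I m = I (max p q)"
          using p[of m] p[of "max p q"] that by auto
        ultimately obtain k where k: "k \<in> N" "k \<oplus>\<^bsub>M\<^esub> x \<bullet>\<^bsub>M\<^esub> a \<in> U (max p q)"
          by (auto simp: I_def)
        have "n \<ominus>\<^bsub>M\<^esub> k = u \<ominus>\<^bsub>M\<^esub> (k \<oplus>\<^bsub>M\<^esub> x \<bullet>\<^bsub>M\<^esub> a)"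
          using na(1,2) k(1) NM x unfolding na(3)
          by (simp add: a_minus_def M.minus_add rsmult_closed M.a_ac M.r_neg M.r_neg2 M.r_neg1)
        also have "\<dots> \<in> U m"
          using right_submodule_diff u k(2) U(2) monoD[OF U(1) that] by blast
        finally have "n \<ominus>\<^bsub>M\<^esub> k \<in> U m \<inter> N" using right_submodule_diff[OF N na(1) k(1)] by simp
        also have "U m \<inter> N = U (max p q) \<inter> N"
          using q[of m] q[of "max p q"] that by auto
        finally have "n \<ominus>\<^bsub>M\<^esub> k \<in> U (max p q)" by simp
        then have "(n \<ominus>\<^bsub>M\<^esub> k) \<oplus>\<^bsub>M\<^esub> (k \<oplus>\<^bsub>M\<^esub> x \<bullet>\<^bsub>M\<^esub> a) \<in> U (max p q)"
          using Ua k(2) by blast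
        moreover have "(n \<ominus>\<^bsub>M\<^esub> k) \<oplus>\<^bsub>M\<^esub> (k \<oplus>\<^bsub>M\<^esub> x \<bullet>\<^bsub>M\<^esub> a) = u"
          using na(1,2) k(1) NM x unfolding na(3)
          by (simp add: a_minus_def rsmult_closed M.a_assoc M.r_neg1)
        ultimately show "u \<in> U (max p q)" by simp
      qed
    qed
    then show "\<exists>n. \<forall>m\<ge>n. U m = U n" by blast
  qed
qed

text \<open>Generators are adjoined one at a time, starting from the zero submodule. It suffices to
  reach some submodule with the chain condition that contains \<open>A\<close>, since it then
  contains the span of \<open>A\<close>, which is \<open>M\<close>.\<close>

lemma (in right_module) finitely_generated_acc:
  assumes "right_noetherian R" "finitely_generated R M"
  shows "ascending_chain_condition (carrier M) R M"
proof -
  obtain A where A: "A \<subseteq> carrier M" "finite A" "right_span R M A = carrier M"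
    using assms(2) by (auto simp: finitely_generated_def)
  have "\<exists>N. right_submodule N R M \<and> A \<subseteq> N \<and> ascending_chain_condition N R M"
    using A(2,1)
  proof (induction rule: finite_induct)
    case empty
    have "right_submodule {\<zero>\<^bsub>M\<^esub>} R M"
      by (simp add: right_submodule_iff rsmult_zero)
    moreover have "U = {\<zero>\<^bsub>M\<^esub>}" if "right_submodule U R M" "U \<subseteq> {\<zero>\<^bsub>M\<^esub>}" for U
      using that by (auto simp: right_submodule_iff)
    then have "ascending_chain_condition {\<zero>\<^bsub>M\<^esub>} R M"
      unfolding ascending_chain_condition_def by metis
    ultimately show ?case by blast
  next
    case (insert x A)
    then obtain N where "right_submodule N R M" "A \<subseteq> N" "ascending_chain_condition N R M"
      by auto
    then show ?case
      using acc_add_cyclic[OF assms(1), of N x] insert.prems by blast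
  qed
  then obtain N where N: "right_submodule N R M" "A \<subseteq> N" "ascending_chain_condition N R M"
    by blast
  then have "carrier M \<subseteq> N" using A(3) by (auto simp: right_span_def)
  with N show ?thesis by (auto simp: right_submodule_iff)
qed

section \<open>Endomorphisms and their images\<close>

lemma endomorphism_closed:
  "\<lbrakk>f \<in> carrier (endomorphism_ring R M); x \<in> carrier M\<rbrakk> \<Longrightarrow> f x \<in> carrier M"
  by (auto simp: endomorphism_ring_def)

lemma (in right_module) endomorphism_zero:
  assumes "f \<in> carrier (endomorphism_ring R M)" shows "f \<zero>\<^bsub>M\<^esub> = \<zero>\<^bsub>M\<^esub>"
proof -
  have "f \<zero>\<^bsub>M\<^esub> \<oplus>\<^bsub>M\<^esub> f \<zero>\<^bsub>M\<^esub> = f \<zero>\<^bsub>M\<^esub>"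
    using assms by (auto simp: endomorphism_ring_def dest: bspec[of _ _ "\<zero>\<^bsub>M\<^esub>"])
  then show ?thesis using endomorphism_closed[OF assms] by simp
qed

lemma (in right_module) right_submodule_endomorphism_image:
  assumes f: "f \<in> carrier (endomorphism_ring R M)"
  shows "right_submodule (f ` carrier M) R M"
proof -
  have "f x \<oplus>\<^bsub>M\<^esub> f y = f (x \<oplus>\<^bsub>M\<^esub> y)" "a \<in> carrier R \<Longrightarrow> f x \<bullet>\<^bsub>M\<^esub> a = f (x \<bullet>\<^bsub>M\<^esub> a)"
    if "x \<in> carrier M" "y \<in> carrier M" for x y a
    using f that by (auto simp: endomorphism_ring_def)
  moreover have "\<zero>\<^bsub>M\<^esub> \<in> f ` carrier M" using endomorphism_zero[OF f] by (metis M.zero_closed image_eqI)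
  ultimately show ?thesis
    unfolding right_submodule_iff using endomorphism_closed[OF f]
    by (auto simp: rsmult_closed)
qed

section \<open>Exchanging kernels and images by central endomorphisms\<close>

lemma ring_center_endomorphism_commute:
  assumes "z \<in> ring_center (endomorphism_ring R M)" "s \<in> carrier (endomorphism_ring R M)"
    "x \<in> carrier M"
  shows "z (s x) = s (z x)"
proof -
  have "z \<otimes>\<^bsub>endomorphism_ring R M\<^esub> s = s \<otimes>\<^bsub>endomorphism_ring R M\<^esub> z"
    using assms by (simp add: ring_center_def)
  from fun_cong[OF this, of x] show ?thesis
    using assms(3) by (simp add: endomorphism_ring_def)
qed

text \<open>The left side says that \<open>z\<close> after \<open>f\<close> is zero, the right side
  that \<open>f\<close> after \<open>z\<close> is zero, and the two composites agree.\<close>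

lemma central_kernel_image_swap:
  assumes z: "z \<in> ring_center (endomorphism_ring R M)"
    and f: "f \<in> carrier (endomorphism_ring R M)"
  shows "f ` carrier M \<subseteq> a_kernel M M z \<longleftrightarrow> z ` carrier M \<subseteq> a_kernel M M f"
proof -
  have "z \<in> carrier (endomorphism_ring R M)" using z by (simp add: ring_center_def)
  then show ?thesis
    using endomorphism_closed[OF f] endomorphism_closed[of z R M]
      ring_center_endomorphism_commute[OF z f]
    by (auto simp: a_kernel_def' image_subset_iff)
qed

lemma centrally_quasi_morphic_image_subset_iff:
  assumes M: "centrally_quasi_morphic R M"
    and f: "f \<in> carrier (endomorphism_ring R M)" and g: "g \<in> carrier (endomorphism_ring R M)"
  shows "f ` carrier M \<subseteq> g ` carrier M \<longleftrightarrow> a_kernel M M g \<subseteq> a_kernel M M f"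
proof -
  \<comment> \<open>\<open>k\<close> presents the kernel of \<open>g\<close> as an image and serves
    the forward direction; \<open>h\<close> presents the image of \<open>g\<close> as a kernel and
    serves the converse.\<close>
  obtain k h where k: "k \<in> ring_center (endomorphism_ring R M)" "a_kernel M M g = k ` carrier M"
    and h: "h \<in> ring_center (endomorphism_ring R M)" "g ` carrier M = a_kernel M M h"
    using M g unfolding centrally_quasi_morphic_def by blast
  note swap = central_kernel_image_swap
  have gk: "g ` carrier M \<subseteq> a_kernel M M k" using swap[OF k(1) g] k(2) by simp
  have hg: "h ` carrier M \<subseteq> a_kernel M M g" using swap[OF h(1) g] h(2) by simp
  show ?thesis
  proof
    assume "f ` carrier M \<subseteq> g ` carrier M"
    then have "f ` carrier M \<subseteq> a_kernel M M k" using gk by (rule order_trans)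
    then show "a_kernel M M g \<subseteq> a_kernel M M f" using swap[OF k(1) f] k(2) by simp
  next
    assume "a_kernel M M g \<subseteq> a_kernel M M f"
    with hg have "h ` carrier M \<subseteq> a_kernel M M f" by (rule order_trans)
    then show "f ` carrier M \<subseteq> g ` carrier M" using swap[OF h(1) f] h(2) by simp
  qed
qed

section \<open>The sequence of central maps and the descent\<close>

lemma (in right_module) centrally_quasi_morphic_imp_centrally_morphic:
  assumes M: "centrally_quasi_morphic R M"
    and acc: "ascending_chain_condition (carrier M) R M"
  shows "centrally_morphic R M"
  unfolding centrally_morphic_def
proof
  fix f assume f: "f \<in> carrier (endomorphism_ring R M)"
  let ?S = "endomorphism_ring R M"
  \<comment> \<open>The choice uses the half of the hypothesis about kernels; the half about images
    enters in the descent, through \<open>centrally_quasi_morphic_image_subset_iff\<close>.\<close>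
  have "\<forall>g\<in>carrier ?S. \<exists>z. z \<in> ring_center ?S \<and> a_kernel M M g = z ` carrier M"
    using M unfolding centrally_quasi_morphic_def by blast
  then obtain c where c: "\<And>g. g \<in> carrier ?S \<Longrightarrow> c g \<in> ring_center ?S"
    "\<And>g. g \<in> carrier ?S \<Longrightarrow> a_kernel M M g = c g ` carrier M"
    by metis
  define F where "F n = (c ^^ n) f" for n
  have F: "F n \<in> carrier ?S" for n
    by (induction n) (use f c(1) in \<open>auto simp: F_def ring_center_def\<close>)
  have ker: "a_kernel M M (F n) = F (Suc n) ` carrier M" for n
    using c(2)[OF F[of n]] by (simp add: F_def)
  \<comment> \<open>Centrality starts at index 1, because \<open>F 0\<close> is the arbitrary
    endomorphism \<open>f\<close>.\<close>
  have central: "F (Suc n) \<in> ring_center ?S" for n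
    using c(1)[OF F[of n]] by (simp add: F_def)
  \<comment> \<open>The image of \<open>F (Suc n)\<close> is the kernel of \<open>F n\<close>;
    swapping puts the image of \<open>F n\<close> into the kernel of \<open>F (Suc n)\<close>, which
    is the next image.\<close>
  have incl: "F n ` carrier M \<subseteq> F (Suc (Suc n)) ` carrier M" for n
    using central_kernel_image_swap[OF central[of n] F[of n]] ker by simp
  \<comment> \<open>The inclusions skip one index, so the even indices are singled out to obtain an
    ascending chain.\<close>
  define U where "U n = F (2 * n) ` carrier M" for n
  have "mono U" by (rule mono_iff_le_Suc[THEN iffD2]) (use incl in \<open>simp add: U_def\<close>)
  moreover have "right_submodule (U n) R M" for n
    unfolding U_def by (rule right_submodule_endomorphism_image[OF F])
  moreover have "U n \<subseteq> carrier M" for n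
    unfolding U_def using endomorphism_closed[OF F] by blast
  ultimately obtain n where "U (Suc n) = U n"
    using acc unfolding ascending_chain_condition_def by (meson le_SucI order_refl)
  then have "F (Suc (Suc (2 * n))) ` carrier M = F (2 * n) ` carrier M"
    by (simp add: U_def)
  \<comment> \<open>The descent lowers the index by one, passing through odd and even indices alike:
    by \<open>ker\<close>, equal images at \<open>m + 1\<close> and \<open>m + 3\<close> are equal
    kernels at \<open>m\<close> and \<open>m + 2\<close>.\<close>
  moreover have "F (Suc (Suc 0)) ` carrier M = F 0 ` carrier M"
    if "F (Suc (Suc m)) ` carrier M = F m ` carrier M" for m
    using that
  proof (induction m)
    case (Suc m)
    then have "a_kernel M M (F (Suc (Suc m))) = a_kernel M M (F m)"
      by (simp add: ker)
    then have "F (Suc (Suc m)) ` carrier M = F m ` carrier M"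
      using centrally_quasi_morphic_image_subset_iff[OF M F F]
      by (metis order_refl subset_antisym)
    then show ?case by (rule Suc.IH)
  qed
  \<comment> \<open>The image of \<open>F 2\<close> is the kernel of \<open>F 1\<close>, so the
    single central map \<open>F 1\<close> serves as witness for both conditions.\<close>
  ultimately have "f ` carrier M = a_kernel M M (F 1)"
    using ker[of 1] by (simp add: F_def)
  moreover have "a_kernel M M f = F 1 ` carrier M"
    using ker[of 0] by (simp add: F_def)
  ultimately show "\<exists>g\<in>ring_center ?S. a_kernel M M f = g ` carrier M \<and> f ` carrier M = a_kernel M M g"
    using central[of 0] by auto
qed

theorem proposition3p20:
  fixes R :: "('r, 'x) ring_scheme" and M :: "('r, 'm, 'y) right_module_scheme"
  assumes "right_module R M"
    and "noetherian R"
    and "finitely_generated R M"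
    and "nonsingular R M"
    and "pure_extending R M"
  shows "centrally_quasi_morphic R M \<longleftrightarrow> centrally_morphic R M"
proof
  interpret right_module R M by fact
  have "ascending_chain_condition (carrier M) R M"
    using assms(2,3) by (intro finitely_generated_acc) (simp_all add: noetherian_def)
  then show "centrally_morphic R M" if "centrally_quasi_morphic R M"
    using that by (rule centrally_quasi_morphic_imp_centrally_morphic[rotated])
  \<comment> \<open>Here one takes \<open>h = g\<close>.\<close>
  show "centrally_quasi_morphic R M" if "centrally_morphic R M"
    using that unfolding centrally_morphic_def centrally_quasi_morphic_def by blast
qed

end
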